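(* Let $n\ge3$ and let $T_n$ be the graph with vertex set $\{1,\ldots,n\}$ and edge set $\{(1,3),(2,3),(3,4),(4,5),\ldots,(n-1,n)\}$. Then the total number of spanning rooted forests of $T_n$ is $f=4\mathcal F_{2n-3}$, and $f_{33}=4\mathcal F_{2n-5}$ and $f_{nn}=4\mathcal F_{2n-4}$.
   Context: $(\mathcal F_k)_{k\ge0}$ are the Fibonacci numbers ($\mathcal F_0=0$, $\mathcal F_1=1$, $\mathcal F_{k+2}=\mathcal F_{k+1}+\mathcal F_k$). A spanning rooted forest of a graph is a spanning acyclic subgraph in which exactly one vertex (the root) is marked in each tree. $f_{ii}$ is the number of spanning rooted forests in which vertex $i$ is a root; $f$ is the total number of spanning rooted forests. $T_n$ is called a T-caterpillar. *)

theory Defs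
  imports "HOL-Number_Theory.Fib"
begin

record 'a ugraph =
  vertices :: "'a set"
  edges :: "'a set set"

definition simple_graph :: "'a ugraph \<Rightarrow> bool" where
  "simple_graph G \<longleftrightarrow> (\<forall>e \<in> edges G. e \<subseteq> vertices G \<and> card e = 2)"

definition adjacent :: "'a ugraph \<Rightarrow> 'a \<Rightarrow> 'a \<Rightarrow> bool" where
  "adjacent G u v \<longleftrightarrow> {u, v} \<in> edges G"

definition spanning_subgraph :: "'a ugraph \<Rightarrow> 'a ugraph \<Rightarrow> bool" where
  "spanning_subgraph H G \<longleftrightarrow> vertices H = vertices G \<and> edges H \<subseteq> edges G"

(* A cycle is given by the list of its distinct vertices, without repeating the first one;
   length at least 3 rules out going back and forth along one edge. *)
definition is_cycle :: "'a ugraph \<Rightarrow> 'a list \<Rightarrow> bool" where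
  "is_cycle G p \<longleftrightarrow> 3 \<le> length p \<and> distinct p \<and> set p \<subseteq> vertices G \<and>
     successively (adjacent G) p \<and> adjacent G (last p) (hd p)"

definition acyclic_graph :: "'a ugraph \<Rightarrow> bool" where
  "acyclic_graph G \<longleftrightarrow> (\<nexists>p. is_cycle G p)"

definition component_of :: "'a ugraph \<Rightarrow> 'a \<Rightarrow> 'a set" where
  "component_of G u = {v \<in> vertices G. (adjacent G)\<^sup>*\<^sup>* u v}"

definition components :: "'a ugraph \<Rightarrow> 'a set set" where
  "components G = component_of G ` vertices G"

(* A rooted forest is a pair of the underlying forest and its set of roots. *)
definition spanning_rooted_forests :: "'a ugraph \<Rightarrow> ('a ugraph \<times> 'a set) set" where
  "spanning_rooted_forests G =
     {(H, R). spanning_subgraph H G \<and> acyclic_graph H \<and>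
        R \<subseteq> vertices H \<and> (\<forall>C \<in> components H. \<exists>!r. r \<in> R \<and> r \<in> C)}"

definition num_rooted_forests :: "'a ugraph \<Rightarrow> nat" where
  "num_rooted_forests G = card (spanning_rooted_forests G)"

definition num_rooted_forests_at :: "'a ugraph \<Rightarrow> 'a \<Rightarrow> nat" where
  "num_rooted_forests_at G i = card {(H, R) \<in> spanning_rooted_forests G. i \<in> R}"

definition T_caterpillar :: "nat \<Rightarrow> nat ugraph" where
  "T_caterpillar n =
     \<lparr>vertices = {1..n}, edges = {{1, 3}, {2, 3}} \<union> {{i, i + 1} | i. 3 \<le> i \<and> i < n}\<rparr>"

lemma simple_graph_T_caterpillar: "3 \<le> n \<Longrightarrow> simple_graph (T_caterpillar n)"
  by (auto simp: simple_graph_def T_caterpillar_def)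

end

theory Submission
  imports Defs
begin

text \<open>
  The caterpillar grows from a single vertex by attaching leaves. Let a leaf \<open>v\<close> be attached to a
  vertex \<open>w\<close> of a graph \<open>G\<close>. A rooted forest of the new graph either omits the new edge, so that
  \<open>v\<close> is an isolated root; or contains it and has its roots in \<open>G\<close>; or contains it and has \<open>v\<close> as a
  root, in which case moving that root to \<open>w\<close> gives a rooted forest of \<open>G\<close> with root \<open>w\<close>. Counting
  the forests whose root set contains a prescribed set, this yields linear recurrences, and along
  the path \<open>3, 4, \<dots>, n\<close> these are the recurrences of consecutive Fibonacci numbers.
\<close>

section \<open>Adding a vertex to a graph, and rootedness in terms of reachability\<close>

definition add_vertex :: "'a ugraph \<Rightarrow> 'a \<Rightarrow> 'a ugraph" where
  "add_vertex G v = \<lparr>vertices = insert v (vertices G), edges = edges G\<rparr>"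

definition add_leaf :: "'a ugraph \<Rightarrow> 'a \<Rightarrow> 'a \<Rightarrow> 'a ugraph" where
  "add_leaf G w v = \<lparr>vertices = insert v (vertices G), edges = insert {w, v} (edges G)\<rparr>"

lemma add_vertex_simps [simp]:
  "vertices (add_vertex G v) = insert v (vertices G)"
  "edges (add_vertex G v) = edges G"
  by (simp_all add: add_vertex_def)

lemma add_leaf_simps [simp]:
  "vertices (add_leaf G w v) = insert v (vertices G)"
  "edges (add_leaf G w v) = insert {w, v} (edges G)"
  by (simp_all add: add_leaf_def)

lemma ugraph_eqI: "vertices G = vertices H \<Longrightarrow> edges G = edges H \<Longrightarrow> G = (H :: 'a ugraph)"
  by (cases G; cases H) simp

text \<open>Transports uniqueness of the root along the contraction of the new edge, which is
  injective on the root sets in question.\<close>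

lemma ex1_image_iff:
  assumes "inj_on f A"
  shows "(\<exists>!y. y \<in> f ` A \<and> P y) \<longleftrightarrow> (\<exists>!x. x \<in> A \<and> P (f x))"
  using assms unfolding inj_on_def Ex1_def by blast

text \<open>Quantifying over vertices instead of components leaves a condition on reachability
  alone, which can be followed when a leaf is attached.\<close>

definition rooted :: "'a ugraph \<Rightarrow> 'a set \<Rightarrow> bool" where
  "rooted H R \<longleftrightarrow> R \<subseteq> vertices H \<and> (\<forall>u \<in> vertices H. \<exists>!r. r \<in> R \<and> (adjacent H)\<^sup>*\<^sup>* u r)"

lemma spanning_rooted_forests_altdef:
  "spanning_rooted_forests G =
     {(H, R). spanning_subgraph H G \<and> acyclic_graph H \<and> rooted H R}"
proof -
  have "R \<subseteq> vertices H \<and> (\<forall>C \<in> components H. \<exists>!r. r \<in> R \<and> r \<in> C) \<longleftrightarrow> rooted H R"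
    for H :: "'a ugraph" and R
  proof -
    have "R \<subseteq> vertices H \<Longrightarrow> r \<in> R \<and> r \<in> component_of H u \<longleftrightarrow> r \<in> R \<and> (adjacent H)\<^sup>*\<^sup>* u r" for u r
      by (auto simp: component_of_def)
    then show ?thesis
      by (cases "R \<subseteq> vertices H") (simp_all add: rooted_def components_def)
  qed
  then show ?thesis
    by (auto simp: spanning_rooted_forests_def)
qed

section \<open>Acyclicity, reachability and roots after attaching a leaf\<close>

lemma acyclic_graph_mono:
  assumes "acyclic_graph G" "vertices H \<subseteq> vertices G" "edges H \<subseteq> edges G"
  shows "acyclic_graph H"
proof -
  have "is_cycle G p" if "is_cycle H p" for p
    using that assms(2,3)
    by (auto simp: is_cycle_def adjacent_def elim!: successively_mono)
  then show ?thesis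
    using assms(1) by (auto simp: acyclic_graph_def)
qed

text \<open>The assumptions pass to spanning subgraphs, so the locale serves both for the whole
  graph and for each of its forests.\<close>

locale leaf_attachment =
  fixes H :: "'a ugraph" and w v :: 'a
  assumes edges_subset: "edges H \<subseteq> Pow (vertices H)"
    and w_in: "w \<in> vertices H" and v_notin: "v \<notin> vertices H"
begin

lemma w_neq_v: "w \<noteq> v"
  using w_in v_notin by auto

lemma not_adjacent: "\<not> adjacent H v x" "\<not> adjacent H x v"
  using edges_subset v_notin by (auto simp: adjacent_def)

lemma adjacent_add_leaf:
  "adjacent (add_leaf H w v) x y \<longleftrightarrow> adjacent H x y \<or> (x = w \<and> y = v) \<or> (x = v \<and> y = w)"
  by (auto simp: adjacent_def doubleton_eq_iff)

lemma adjacent_add_vertex: "adjacent (add_vertex H v) = adjacent H"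
  by (auto simp: adjacent_def fun_eq_iff)

lemma acyclic_add_leaf:
  assumes "acyclic_graph H"
  shows "acyclic_graph (add_leaf H w v)"
  unfolding acyclic_graph_def
proof
  assume "\<exists>p. is_cycle (add_leaf H w v) p"
  then obtain p where p: "is_cycle (add_leaf H w v) p" ..
  show False
  proof (cases "v \<in> set p")
    case False
    have "p \<noteq> []"
      using p by (auto simp: is_cycle_def)
    then have "last p \<noteq> v" "hd p \<noteq> v"
      using False by (metis last_in_set, metis hd_in_set)
    moreover have "successively (adjacent H) p"
      using p False
      by (auto simp: is_cycle_def adjacent_add_leaf elim!: successively_mono)
    ultimately have "is_cycle H p"
      using p False by (auto simp: is_cycle_def adjacent_add_leaf)
    then show False
      using assms by (auto simp: acyclic_graph_def)
  next
    case True
    txt \<open>Both neighbours of \<open>v\<close> on the cycle would be \<open>w\<close>.\<close>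
    then obtain xs ys where split: "p = xs @ v # ys"
      by (meson split_list)
    have w: "x = w" if "adjacent (add_leaf H w v) x v \<or> adjacent (add_leaf H w v) v x" for x
      using that not_adjacent w_neq_v by (auto simp: adjacent_add_leaf)
    have len: "3 \<le> length p" and dist: "distinct p"
      and succ: "successively (adjacent (add_leaf H w v)) p"
      and closed: "adjacent (add_leaf H w v) (last p) (hd p)"
      using p by (auto simp: is_cycle_def)
    \<comment> \<open>If \<open>v\<close> stands at an end of the list, the rest of the list begins
      and ends with a neighbour of \<open>v\<close>, one of them through the closing edge;
      distinctness then forbids that both are \<open>w\<close>.\<close>
    have ends: False if "zs \<noteq> []" "hd zs = last zs" "distinct zs" "2 \<le> length zs" for zs :: "'a list"
      using that by (cases zs) (auto split: if_splits)
    consider "xs = []" | "ys = []" | "xs \<noteq> []" "ys \<noteq> []"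
      by blast
    then show False
    proof cases
      case 1
      then have "ys \<noteq> []"
        using len split by auto
      then have "hd ys = w" "last ys = w"
        using succ closed split 1 w by (auto simp: successively_Cons)
      then show False
        using ends[of ys] \<open>ys \<noteq> []\<close> dist len split 1 by auto
    next
      case 2
      then have "xs \<noteq> []"
        using len split by auto
      then have "hd xs = w" "last xs = w"
        using succ closed split 2 w by (auto simp: successively_append_iff)
      then show False
        using ends[of xs] \<open>xs \<noteq> []\<close> dist len split 2 by auto
    next
      case 3
      then have "last xs = w" "hd ys = w"
        using succ split w by (auto simp: successively_append_iff successively_Cons)
      then have "w \<in> set xs" "w \<in> set ys"
        using 3 by (metis last_in_set, metis hd_in_set)
      then show False
        using dist split by auto
    qed
  qed
qed

lemma acyclic_add_leaf_iff: "acyclic_graph (add_leaf H w v) \<longleftrightarrow> acyclic_graph H"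
  using acyclic_add_leaf acyclic_graph_mono[of "add_leaf H w v" H] by auto

text \<open>\<open>add_vertex H v\<close> lies between \<open>H\<close> and
  \<open>add_leaf H w v\<close>, so monotonicity gives both directions.\<close>

lemma acyclic_add_vertex_iff: "acyclic_graph (add_vertex H v) \<longleftrightarrow> acyclic_graph H"
  using acyclic_graph_mono[of "add_vertex H v" H] acyclic_add_leaf
    acyclic_graph_mono[of "add_leaf H w v" "add_vertex H v"] by auto

lemma reachable_v_iff: "(adjacent H)\<^sup>*\<^sup>* v x \<longleftrightarrow> x = v" "(adjacent H)\<^sup>*\<^sup>* x v \<longleftrightarrow> x = v"
proof -
  show "(adjacent H)\<^sup>*\<^sup>* v x \<longleftrightarrow> x = v"
    using not_adjacent by (metis converse_rtranclpE rtranclp.rtrancl_refl)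
  show "(adjacent H)\<^sup>*\<^sup>* x v \<longleftrightarrow> x = v"
    using not_adjacent by (metis rtranclp.cases rtranclp.rtrancl_refl)
qed

text \<open>Contracting the new edge maps walks of the new graph to walks of the old one.\<close>

lemma reachable_add_leaf_iff:
  "(adjacent (add_leaf H w v))\<^sup>*\<^sup>* x y \<longleftrightarrow>
     (adjacent H)\<^sup>*\<^sup>* (if x = v then w else x) (if y = v then w else y)"
    (is "?reach' x y \<longleftrightarrow> (adjacent H)\<^sup>*\<^sup>* (?c x) (?c y)")
proof
  assume "?reach' x y"
  then show "(adjacent H)\<^sup>*\<^sup>* (?c x) (?c y)"
  proof induction
    case base
    show ?case by simp
  next
    case (step y z)
    have "?c y = ?c z \<or> adjacent H (?c y) (?c z)"
      using step.hyps(2) not_adjacent w_neq_v by (auto simp: adjacent_add_leaf)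
    then show ?case
    proof
      assume "?c y = ?c z"
      with step.IH show ?case by (simp only:)
    next
      assume "adjacent H (?c y) (?c z)"
      with step.IH show ?case by (rule rtranclp.rtrancl_into_rtrancl)
    qed
  qed
next
  assume "(adjacent H)\<^sup>*\<^sup>* (?c x) (?c y)"
  then have "?reach' (?c x) (?c y)"
    by (rule rtranclp_mono[THEN predicate2D, rotated]) (auto simp: adjacent_add_leaf)
  moreover have "?reach' x (?c x)" "?reach' (?c y) y"
    by (auto simp: adjacent_add_leaf)
  ultimately show "?reach' x y"
    by (meson rtranclp_trans)
qed

text \<open>The isolated vertex \<open>v\<close> forms a component of its own, so it must be its own
  root and serves no other vertex.\<close>

lemma rooted_add_vertex_iff:
  "rooted (add_vertex H v) R \<longleftrightarrow> v \<in> R \<and> rooted H (R - {v})"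
proof -
  have "(r \<in> R \<and> (adjacent H)\<^sup>*\<^sup>* u r) \<longleftrightarrow> (r \<in> R - {v} \<and> (adjacent H)\<^sup>*\<^sup>* u r)"
    if "u \<in> vertices H" for u r
    using that v_notin by (auto simp: reachable_v_iff)
  then show ?thesis
    by (auto simp: rooted_def adjacent_add_vertex reachable_v_iff)
qed

text \<open>Among roots other than \<open>v\<close>, the leaf reaches the same ones as
  \<open>w\<close>, so its condition repeats that of \<open>w\<close>.\<close>

lemma rooted_add_leaf_without_iff:
  assumes "v \<notin> R"
  shows "rooted (add_leaf H w v) R \<longleftrightarrow> rooted H R"
proof -
  have "(r \<in> R \<and> (adjacent (add_leaf H w v))\<^sup>*\<^sup>* u r) \<longleftrightarrow>
      (r \<in> R \<and> (adjacent H)\<^sup>*\<^sup>* (if u = v then w else u) r)" for u r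
    using assms by (auto simp: reachable_add_leaf_iff)
  then show ?thesis
    using assms w_in v_notin unfolding rooted_def by auto
qed

text \<open>As \<open>v\<close> and \<open>w\<close> share a component, they cannot both be roots.
  If only \<open>v\<close> is one, contracting the new edge moves this root to \<open>w\<close> and
  keeps the others.\<close>

lemma rooted_add_leaf_with_iff:
  assumes "v \<in> R"
  shows "rooted (add_leaf H w v) R \<longleftrightarrow> w \<notin> R \<and> rooted H (insert w (R - {v}))"
proof (cases "w \<in> R")
  case True
  have "(adjacent (add_leaf H w v))\<^sup>*\<^sup>* w v"
    by (auto simp: adjacent_add_leaf)
  then have "\<not> (\<exists>!r. r \<in> R \<and> (adjacent (add_leaf H w v))\<^sup>*\<^sup>* w r)"
    using True assms w_neq_v by blast
  then have "\<not> rooted (add_leaf H w v) R"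
    unfolding rooted_def using w_in by (metis add_leaf_simps(1) insertI2)
  then show ?thesis
    using True by simp
next
  case False
  let ?c = "\<lambda>x. if x = v then w else x"
  let ?R = "insert w (R - {v})"
  have unique: "(\<exists>!r. r \<in> R \<and> (adjacent (add_leaf H w v))\<^sup>*\<^sup>* u r) \<longleftrightarrow>
      (\<exists>!r. r \<in> ?R \<and> (adjacent H)\<^sup>*\<^sup>* (?c u) r)" for u
  proof -
    have inj: "inj_on ?c R" and image: "?c ` R = ?R"
      using assms False by (auto simp: inj_on_def)
    have "(\<exists>!r. r \<in> ?R \<and> P r) \<longleftrightarrow> (\<exists>!r. r \<in> R \<and> P (?c r))" for P
      using ex1_image_iff[OF inj, of P] unfolding image .
    then show ?thesis
      unfolding reachable_add_leaf_iff by simp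
  qed
  have all: "(\<forall>u \<in> insert v (vertices H). Q (?c u)) \<longleftrightarrow> (\<forall>u \<in> vertices H. Q u)" for Q
    using w_in v_notin by auto
  have sub: "R \<subseteq> insert v (vertices H) \<longleftrightarrow> ?R \<subseteq> vertices H"
    using w_in v_notin by auto
  show ?thesis
    unfolding rooted_def add_leaf_simps unique sub
      all[of "\<lambda>u. \<exists>!r. r \<in> ?R \<and> (adjacent H)\<^sup>*\<^sup>* u r"]
    using False by simp
qed

end

text \<open>A whole set of prescribed roots is allowed because the recurrences enlarge this set by
  \<open>w\<close>; the sets \<open>{}\<close> and \<open>{i}\<close> give the two counts of the
  theorem.\<close>

definition forests_rooted_at :: "'a ugraph \<Rightarrow> 'a set \<Rightarrow> ('a ugraph \<times> 'a set) set" where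
  "forests_rooted_at G S = {(H, R) \<in> spanning_rooted_forests G. S \<subseteq> R}"

lemma num_rooted_forests_eq: "num_rooted_forests G = card (forests_rooted_at G {})"
  by (simp add: num_rooted_forests_def forests_rooted_at_def)

lemma num_rooted_forests_at_eq: "num_rooted_forests_at G i = card (forests_rooted_at G {i})"
  by (simp add: num_rooted_forests_at_def forests_rooted_at_def)

lemma finite_forests_rooted_at:
  assumes "finite (vertices G)" "edges G \<subseteq> Pow (vertices G)"
  shows "finite (forests_rooted_at G S)"
proof -
  have "forests_rooted_at G S \<subseteq>
      (\<lambda>E. \<lparr>vertices = vertices G, edges = E\<rparr>) ` Pow (edges G) \<times> Pow (vertices G)"
    by (auto simp: forests_rooted_at_def spanning_rooted_forests_def spanning_subgraph_def
        intro!: image_eqI ugraph_eqI)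
  moreover have "finite (edges G)"
    using assms by (auto intro: finite_subset)
  ultimately show ?thesis
    using assms(1) by (auto intro: finite_subset)
qed

section \<open>The three kinds of rooted forests after attaching a leaf\<close>

context leaf_attachment
begin

lemma spanning_subgraph_attachment:
  "spanning_subgraph K H \<Longrightarrow> leaf_attachment K w v"
  using edges_subset w_in v_notin
  by unfold_locales (auto simp: spanning_subgraph_def)

lemma new_edge_notin: "spanning_subgraph K H \<Longrightarrow> {w, v} \<notin> edges K"
  using edges_subset v_notin by (auto simp: spanning_subgraph_def)

lemma spanning_subgraph_add_leafE:
  assumes "spanning_subgraph K (add_leaf H w v)"
  obtains L where "spanning_subgraph L H" "K = add_vertex L v \<or> K = add_leaf L w v"
proof -
  define L where "L = \<lparr>vertices = vertices H, edges = edges K - {{w, v}}\<rparr>"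
  have "spanning_subgraph L H"
    using assms by (auto simp: spanning_subgraph_def L_def)
  moreover have "K = add_vertex L v \<or> K = add_leaf L w v"
  proof (cases "{w, v} \<in> edges K")
    case True
    then have "K = add_leaf L w v"
      using assms by (intro ugraph_eqI) (auto simp: spanning_subgraph_def L_def)
    then show ?thesis ..
  next
    case False
    then have "K = add_vertex L v"
      using assms by (intro ugraph_eqI) (auto simp: spanning_subgraph_def L_def)
    then show ?thesis ..
  qed
  ultimately show thesis
    using that by blast
qed

abbreviation isolate :: "'a ugraph \<times> 'a set \<Rightarrow> 'a ugraph \<times> 'a set" where
  "isolate \<equiv> \<lambda>(K, R). (add_vertex K v, insert v R)"

abbreviation hang :: "'a ugraph \<times> 'a set \<Rightarrow> 'a ugraph \<times> 'a set" where
  "hang \<equiv> \<lambda>(K, R). (add_leaf K w v, R)"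

text \<open>Intended for root sets that contain \<open>w\<close>: the root of the component of
  \<open>w\<close> moves to the new leaf.\<close>

abbreviation reroot :: "'a ugraph \<times> 'a set \<Rightarrow> 'a ugraph \<times> 'a set" where
  "reroot \<equiv> \<lambda>(K, R). (add_leaf K w v, insert v (R - {w}))"

text \<open>The kinds are told apart by whether the new edge is present and, if so, whether
  \<open>v\<close> is a root.\<close>

lemma spanning_rooted_forests_add_leaf:
  "spanning_rooted_forests (add_leaf H w v) =
     isolate ` spanning_rooted_forests H \<union> hang ` spanning_rooted_forests H \<union>
     reroot ` forests_rooted_at H {w}" (is "?L = ?A \<union> ?B \<union> ?C")
proof (intro equalityI subsetI)
  fix x
  assume "x \<in> ?L"
  then obtain K R where x: "x = (K, R)" and K: "spanning_subgraph K (add_leaf H w v)"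
    and acyclic: "acyclic_graph K" and rooted: "rooted K R"
    by (auto simp: spanning_rooted_forests_altdef)
  from K obtain L where L: "spanning_subgraph L H" and
    "K = add_vertex L v \<or> K = add_leaf L w v"
    by (rule spanning_subgraph_add_leafE)
  interpret L: leaf_attachment L w v
    using L by (rule spanning_subgraph_attachment)
  from \<open>K = add_vertex L v \<or> K = add_leaf L w v\<close> show "x \<in> ?A \<union> ?B \<union> ?C"
  proof
    assume K: "K = add_vertex L v"
    then have "(L, R - {v}) \<in> spanning_rooted_forests H" "x = isolate (L, R - {v})"
      using x L acyclic rooted
      by (auto simp: spanning_rooted_forests_altdef L.acyclic_add_vertex_iff L.rooted_add_vertex_iff)
    then show ?thesis by blast
  next
    assume K: "K = add_leaf L w v"
    show ?thesis
    proof (cases "v \<in> R")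
      case False
      then have "(L, R) \<in> spanning_rooted_forests H" "x = hang (L, R)"
        using x K L acyclic rooted
        by (auto simp: spanning_rooted_forests_altdef L.acyclic_add_leaf_iff
            L.rooted_add_leaf_without_iff)
      then show ?thesis by blast
    next
      case True
      \<comment> \<open>Here \<open>w \<notin> R\<close>, so moving the root from \<open>v\<close>
        back to \<open>w\<close> is inverse to \<open>reroot\<close>.\<close>
      then have "(L, insert w (R - {v})) \<in> forests_rooted_at H {w}"
        "x = reroot (L, insert w (R - {v}))"
        using x K L acyclic rooted w_neq_v
        by (auto simp: forests_rooted_at_def spanning_rooted_forests_altdef
            L.acyclic_add_leaf_iff L.rooted_add_leaf_with_iff)
      then show ?thesis by blast
    qed
  qed
next
  fix x
  assume "x \<in> ?A \<union> ?B \<union> ?C"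
  then obtain K R where KR: "(K, R) \<in> spanning_rooted_forests H"
    and x: "x = isolate (K, R) \<or> x = hang (K, R) \<or> w \<in> R \<and> x = reroot (K, R)"
    by (auto simp: forests_rooted_at_def)
  have K: "spanning_subgraph K H" and acyclic: "acyclic_graph K" and rooted: "rooted K R"
    using KR by (auto simp: spanning_rooted_forests_altdef)
  interpret K: leaf_attachment K w v
    using K by (rule spanning_subgraph_attachment)
  have v: "v \<notin> R"
    using rooted K.v_notin by (auto simp: rooted_def)
  have "spanning_subgraph (add_vertex K v) (add_leaf H w v)"
    "spanning_subgraph (add_leaf K w v) (add_leaf H w v)"
    using K by (auto simp: spanning_subgraph_def)
  moreover have "w \<in> R \<Longrightarrow> insert w (insert v (R - {w}) - {v}) = R"
    using v w_neq_v by auto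
  ultimately have "isolate (K, R) \<in> ?L" "hang (K, R) \<in> ?L" "w \<in> R \<Longrightarrow> reroot (K, R) \<in> ?L"
    using acyclic rooted v w_neq_v
    by (simp_all add: spanning_rooted_forests_altdef K.acyclic_add_vertex_iff K.acyclic_add_leaf_iff
        K.rooted_add_vertex_iff K.rooted_add_leaf_without_iff K.rooted_add_leaf_with_iff)
  then show "x \<in> ?L"
    using x by blast
qed

text \<open>The leaf and its edge are new to every forest of \<open>H\<close>; this allows
  cancelling the insertions in the injectivity and disjointness proofs.\<close>

lemma spanning_rooted_forestsD:
  assumes "(K, R) \<in> spanning_rooted_forests H"
  shows "v \<notin> R" "v \<notin> vertices K" "{w, v} \<notin> edges K" "vertices K = vertices H"
  using assms v_notin new_edge_notin[of K]
  by (auto simp: spanning_rooted_forests_def spanning_subgraph_def)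

lemma inj_on_attachments:
  "inj_on isolate (spanning_rooted_forests H)"
  "inj_on hang (spanning_rooted_forests H)"
  "inj_on reroot (forests_rooted_at H {w})"
proof -
  have eq: "K = K'" if "edges K = edges K'"
    "(K, R) \<in> spanning_rooted_forests H" "(K', R') \<in> spanning_rooted_forests H" for K K' R R'
    using that spanning_rooted_forestsD(4) by (metis ugraph_eqI)
  show "inj_on isolate (spanning_rooted_forests H)"
  proof (rule inj_onI, clarify)
    fix K R K' R'
    assume *: "(K, R) \<in> spanning_rooted_forests H" "(K', R') \<in> spanning_rooted_forests H"
      "add_vertex K v = add_vertex K' v" "insert v R = insert v R'"
    then have "edges K = edges K'"
      by (metis add_vertex_simps(2))
    then show "K = K' \<and> R = R'"
      using * eq spanning_rooted_forestsD(1) by (metis insert_ident)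
  qed
  have leaf_eq: "K = K'" if "add_leaf K w v = add_leaf K' w v"
    "(K, R) \<in> spanning_rooted_forests H" "(K', R') \<in> spanning_rooted_forests H" for K K' R R'
  proof -
    have "insert {w, v} (edges K) = insert {w, v} (edges K')"
      using that(1) by (metis add_leaf_simps(2))
    then show ?thesis
      using that eq spanning_rooted_forestsD(3) by (metis insert_ident)
  qed
  then show "inj_on hang (spanning_rooted_forests H)"
    by (auto intro!: inj_onI)
  show "inj_on reroot (forests_rooted_at H {w})"
  proof (rule inj_onI, clarify)
    fix K R K' R'
    assume *: "(K, R) \<in> forests_rooted_at H {w}" "(K', R') \<in> forests_rooted_at H {w}"
      "add_leaf K w v = add_leaf K' w v" "insert v (R - {w}) = insert v (R' - {w})"
    then have F: "(K, R) \<in> spanning_rooted_forests H" "(K', R') \<in> spanning_rooted_forests H"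
      and "w \<in> R" "w \<in> R'"
      by (auto simp: forests_rooted_at_def)
    have "v \<notin> R - {w}" "v \<notin> R' - {w}"
      using spanning_rooted_forestsD(1) F by auto
    then have "R - {w} = R' - {w}"
      using *(4) by (metis insert_ident)
    then have "R = R'"
      \<comment> \<open>No information is lost by removing \<open>w\<close>, since it is known to
        belong to both root sets.\<close>
      using \<open>w \<in> R\<close> \<open>w \<in> R'\<close> by (metis insert_Diff)
    then show "K = K' \<and> R = R'"
      using leaf_eq[OF *(3) F] by simp
  qed
qed

lemma isolate_neq:
  assumes "(K, R) \<in> spanning_rooted_forests H"
  shows "add_vertex K v \<noteq> add_leaf K' w v"
proof
  assume "add_vertex K v = add_leaf K' w v"
  then have "edges K = insert {w, v} (edges K')"
    by (metis add_leaf_simps(2) add_vertex_simps(2))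
  then show False
    using spanning_rooted_forestsD(3)[OF assms] by blast
qed

text \<open>The new edge separates the first family from the other two, and the root
  \<open>v\<close> separates the second from the third. Subfamilies are allowed because prescribing
  roots selects from each family.\<close>

lemma card_attachments:
  assumes "X \<subseteq> spanning_rooted_forests H" "Y \<subseteq> spanning_rooted_forests H"
    "Z \<subseteq> forests_rooted_at H {w}" "finite X" "finite Y" "finite Z"
  shows "card (isolate ` X \<union> hang ` Y \<union> reroot ` Z) = card X + card Y + card Z"
proof -
  have "isolate ` X \<inter> hang ` Y = {}"
    using assms(1) isolate_neq by fastforce
  moreover have "(isolate ` X \<union> hang ` Y) \<inter> reroot ` Z = {}"
  proof -
    have "isolate ` X \<inter> reroot ` Z = {}"
      using assms(1) isolate_neq by fastforce
    moreover have "hang ` Y \<inter> reroot ` Z = {}"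
      using assms(2) spanning_rooted_forestsD(1) by fastforce
    ultimately show ?thesis by blast
  qed
  ultimately show ?thesis
    using assms inj_on_attachments
    by (simp add: card_Un_disjoint card_image[OF inj_on_subset])
qed

end

section \<open>Recurrences for the number of forests with prescribed roots\<close>

locale finite_leaf_attachment = leaf_attachment +
  assumes finite_vertices: "finite (vertices H)"
begin

text \<open>Isolating and hanging the leaf each preserve the roots in \<open>S\<close>, which gives
  the factor 2; prescribing \<open>v\<close> excludes hanging. Rerooting removes \<open>w\<close>
  from the roots, so it contributes only if \<open>w \<notin> S\<close>, and it starts from forests
  with \<open>w\<close> as a further root.\<close>

lemma card_forests_add_leaf:
  assumes "S \<subseteq> vertices H"
  shows "card (forests_rooted_at (add_leaf H w v) S) =
      2 * card (forests_rooted_at H S) +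
      (if w \<in> S then 0 else card (forests_rooted_at H (insert w S)))"
    and "card (forests_rooted_at (add_leaf H w v) (insert v S)) =
      card (forests_rooted_at H S) +
      (if w \<in> S then 0 else card (forests_rooted_at H (insert w S)))"
proof -
  define Z where "Z = (if w \<in> S then {} else forests_rooted_at H (insert w S))"
  let ?X = "forests_rooted_at H S"
  have v: "v \<notin> S"
    using assms v_notin by auto
  have fin: "finite (forests_rooted_at H U)" for U
    using finite_vertices edges_subset by (rule finite_forests_rooted_at)
  have sub: "?X \<subseteq> spanning_rooted_forests H" "Z \<subseteq> forests_rooted_at H {w}"
    by (auto simp: forests_rooted_at_def Z_def)
  have "finite Z"
    by (simp add: Z_def fin)
  have card_Z: "card Z = (if w \<in> S then 0 else card (forests_rooted_at H (insert w S)))"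
    by (simp add: Z_def)
  have mem: "x \<in> forests_rooted_at G U \<longleftrightarrow> x \<in> spanning_rooted_forests G \<and> U \<subseteq> snd x"
    for x :: "'a ugraph \<times> 'a set" and G U
    by (cases x) (auto simp: forests_rooted_at_def)
  have vR: "v \<notin> snd x" if "x \<in> spanning_rooted_forests H" for x
    using that spanning_rooted_forestsD(1) by (cases x) auto
  have restrict: "{y \<in> f ` A \<union> g ` B \<union> h ` C. P y} =
      f ` {x \<in> A. P (f x)} \<union> g ` {x \<in> B. P (g x)} \<union> h ` {x \<in> C. P (h x)}"
    for f g h :: "'b \<Rightarrow> 'c" and A B C P
    by auto
  have split: "forests_rooted_at (add_leaf H w v) U =
      isolate ` {x \<in> spanning_rooted_forests H. U \<subseteq> snd (isolate x)} \<union>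
      hang ` {x \<in> spanning_rooted_forests H. U \<subseteq> snd (hang x)} \<union>
      reroot ` {x \<in> forests_rooted_at H {w}. U \<subseteq> snd (reroot x)}" for U
  proof -
    have "forests_rooted_at (add_leaf H w v) U =
        {y \<in> spanning_rooted_forests (add_leaf H w v). U \<subseteq> snd y}"
      by (auto simp: mem)
    then show ?thesis
      unfolding spanning_rooted_forests_add_leaf restrict .
  qed
  have "{x \<in> spanning_rooted_forests H. S \<subseteq> snd (isolate x)} = ?X"
    "{x \<in> spanning_rooted_forests H. insert v S \<subseteq> snd (isolate x)} = ?X"
    "{x \<in> spanning_rooted_forests H. S \<subseteq> snd (hang x)} = ?X"
    using v by (auto simp: forests_rooted_at_def)
  moreover have "{x \<in> spanning_rooted_forests H. insert v S \<subseteq> snd (hang x)} = {}"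
    using vR by (auto split: prod.splits)
  moreover have "{x \<in> forests_rooted_at H {w}. S \<subseteq> snd (reroot x)} = Z"
    "{x \<in> forests_rooted_at H {w}. insert v S \<subseteq> snd (reroot x)} = Z"
    using v w_neq_v by (auto simp: forests_rooted_at_def Z_def)
  ultimately have "forests_rooted_at (add_leaf H w v) S = isolate ` ?X \<union> hang ` ?X \<union> reroot ` Z"
    "forests_rooted_at (add_leaf H w v) (insert v S) = isolate ` ?X \<union> hang ` {} \<union> reroot ` Z"
    using split[of S] split[of "insert v S"] by (simp_all only:)
  then show "card (forests_rooted_at (add_leaf H w v) S) =
      2 * card (forests_rooted_at H S) +
      (if w \<in> S then 0 else card (forests_rooted_at H (insert w S)))"
    and "card (forests_rooted_at (add_leaf H w v) (insert v S)) =
      card (forests_rooted_at H S) +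
      (if w \<in> S then 0 else card (forests_rooted_at H (insert w S)))"
    using card_attachments[of ?X ?X Z] card_attachments[of ?X "{}" Z] sub fin \<open>finite Z\<close> card_Z
    by simp_all
qed

end

section \<open>The counts for the T-caterpillar\<close>

lemma forests_rooted_at_singleton:
  assumes "S \<subseteq> {a}"
  shows "card (forests_rooted_at \<lparr>vertices = {a}, edges = {}\<rparr> S) = 1"
proof -
  let ?G = "\<lparr>vertices = {a}, edges = {}\<rparr>"
  have adj: "adjacent ?G = (\<lambda>_ _. False)"
    by (simp add: adjacent_def fun_eq_iff)
  have "(\<lambda>_ _. False)\<^sup>*\<^sup>* x y \<longleftrightarrow> x = y" for x y :: 'a
    by (metis converse_rtranclpE rtranclp.rtrancl_refl)
  then have "rooted ?G R \<longleftrightarrow> R = {a}" for R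
    by (auto simp: rooted_def adj)
  moreover have "acyclic_graph ?G"
    by (auto simp: acyclic_graph_def is_cycle_def adj)
  moreover have "spanning_subgraph K ?G \<longleftrightarrow> K = ?G" for K
    by (auto simp: spanning_subgraph_def intro: ugraph_eqI)
  ultimately have "forests_rooted_at ?G S = {(?G, {a})}"
    using assms by (auto simp: forests_rooted_at_def spanning_rooted_forests_altdef)
  then show ?thesis by simp
qed

lemma T_caterpillar_3:
  "T_caterpillar 3 = add_leaf (add_leaf \<lparr>vertices = {3}, edges = {}\<rparr> 3 1) 3 2"
  by (rule ugraph_eqI) (auto simp: T_caterpillar_def)

lemma T_caterpillar_Suc:
  "3 \<le> n \<Longrightarrow> T_caterpillar (Suc n) = add_leaf (T_caterpillar n) n (Suc n)"
  by (rule ugraph_eqI) (auto simp: T_caterpillar_def less_Suc_eq)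

lemma T_caterpillar_attachment:
  assumes "3 \<le> n"
  shows "finite_leaf_attachment (T_caterpillar n) n (Suc n)"
  using assms by unfold_locales (auto simp: T_caterpillar_def)

lemma card_forests_T_caterpillar_3:
  "card (forests_rooted_at (T_caterpillar 3) {}) = 8"
  "card (forests_rooted_at (T_caterpillar 3) {3}) = 4"
proof -
  let ?G = "\<lparr>vertices = {3::nat}, edges = {}\<rparr>"
  interpret A: finite_leaf_attachment ?G 3 1
    by unfold_locales auto
  interpret B: finite_leaf_attachment "add_leaf ?G 3 1" 3 2
    by unfold_locales auto
  show "card (forests_rooted_at (T_caterpillar 3) {}) = 8"
    "card (forests_rooted_at (T_caterpillar 3) {3}) = 4"
    \<comment> \<open>A leaf at \<open>3\<close> turns the counts \<open>(a, b)\<close> for the root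
      sets \<open>{}\<close> and \<open>{3}\<close> into \<open>(2a + b, 2b)\<close>, hence (1, 1),
      (3, 2), (8, 4). Deleting \<open>One_nat_def\<close> keeps the vertex \<open>1\<close> from
      becoming \<open>Suc 0\<close>.\<close>
    by (simp_all add: T_caterpillar_3 B.card_forests_add_leaf(1) A.card_forests_add_leaf(1)
        forests_rooted_at_singleton del: One_nat_def)
qed

text \<open>In the last conjunct the value \<open>0\<close> at \<open>n = 3\<close> makes the recurrence uniform in \<open>n\<close>.\<close>

lemma card_forests_T_caterpillar:
  assumes "3 \<le> n"
  shows "card (forests_rooted_at (T_caterpillar n) {}) = 4 * fib (2 * n - 3) \<and>
    card (forests_rooted_at (T_caterpillar n) {n}) = 4 * fib (2 * n - 4) \<and>
    card (forests_rooted_at (T_caterpillar n) {3}) = 4 * fib (2 * n - 5) \<and>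
    (if n = 3 then 0 else card (forests_rooted_at (T_caterpillar n) {n, 3})) = 4 * fib (2 * n - 6)"
  using assms
proof (induction n rule: dec_induct)
  case base
  have "fib 2 = 1" "fib 3 = 2"
    by (simp_all add: numeral_eq_Suc)
  then show ?case
    by (simp add: card_forests_T_caterpillar_3)
next
  case (step n)
  interpret finite_leaf_attachment "T_caterpillar n" n "Suc n"
    using step.hyps(1) by (rule T_caterpillar_attachment)
  \<comment> \<open>With \<open>n = k + 3\<close> none of the differences in the indices is
    truncated.\<close>
  obtain k where n: "n = k + 3"
    using step.hyps(1) by (metis add.commute le_Suc_ex)
  have "{} \<subseteq> vertices (T_caterpillar n)" "{3} \<subseteq> vertices (T_caterpillar n)"
    using step.hyps(1) by (auto simp: T_caterpillar_def)
  note rec = this[THEN card_forests_add_leaf(1)] this[THEN card_forests_add_leaf(2)]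
  \<comment> \<open>The Fibonacci recurrence, applied twice in the first and third equations,
    matches the two forms of the counting recurrence.\<close>
  have fib: "fib (2 * Suc n - 3) = 2 * fib (2 * n - 3) + fib (2 * n - 4)"
    "fib (2 * Suc n - 4) = fib (2 * n - 3) + fib (2 * n - 4)"
    "fib (2 * Suc n - 5) = 2 * fib (2 * n - 5) + fib (2 * n - 6)"
    "fib (2 * Suc n - 6) = fib (2 * n - 5) + fib (2 * n - 6)"
    by (simp_all add: n numeral_eq_Suc)
  show ?case
    \<comment> \<open>For \<open>S = {3}\<close> the condition \<open>w \<in> S\<close> reads
      \<open>n = 3\<close>, which is where the last conjunct has the value 0.\<close>
    unfolding T_caterpillar_Suc[OF step.hyps(1)] rec fib
    using step.IH step.hyps(1) by (auto split: if_splits)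
qed

theorem theorem3:
  fixes n :: nat
  assumes "n \<ge> 3"
  shows "num_rooted_forests (T_caterpillar n) = 4 * fib (2 * n - 3) \<and>
         num_rooted_forests_at (T_caterpillar n) 3 = 4 * fib (2 * n - 5) \<and>
         num_rooted_forests_at (T_caterpillar n) n = 4 * fib (2 * n - 4)"
  using card_forests_T_caterpillar[OF assms]
  by (simp add: num_rooted_forests_eq num_rooted_forests_at_eq)

end
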